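(* For all $p\in\mathbb{C}$ with $0<|p|$ sufficiently small, \[3\,g(p)=n\!\left(\frac{27p}{(1+4p)^3}\right)+4\,n\!\left(\frac{27p^2}{(1-2p)^3}\right).\] Furthermore, for all $u\in\mathbb{C}$ with $0<|u|$ sufficiently small, \[3\,n\!\left(\frac{27u(1+u)^4}{2(1+4u+u^2)^3}\right)=g\!\left(\frac{u}{2(1+u)^2}\right)-8\,g\!\left(-\frac{u(1+u)}{2}\right)+4\,g\!\left(\frac{u^2}{4(1+u)}\right).\]
   Context: $\mathrm{m}$ is the logarithmic Mahler measure $\mathrm{m}(P)=\int_0^1\int_0^1\log|P(e^{2\pi i\theta_1},e^{2\pi i\theta_2})|d\theta_1d\theta_2$; $n(t)=\mathrm{m}\!\left(x^3+y^3+1-\frac{3}{t^{1/3}}xy\right)$ and $g(t)=\mathrm{m}\!\left((x+y)(x+1)(y+1)-\frac1t xy\right)$. *)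

theory Defs
  imports "HOL-Analysis.Analysis"
begin

definition mahler2 :: "(complex \<Rightarrow> complex \<Rightarrow> complex) \<Rightarrow> real" where
  "mahler2 P = (LINT t1:{0..1}|lborel. LINT t2:{0..1}|lborel.
      ln (cmod (P (cis (2 * pi * t1)) (cis (2 * pi * t2)))))"

text \<open>n(t) = m(x^3 + y^3 + 1 - 3 t^(-1/3) x y); principal cube root (the value is
  independent of the branch, since x \<mapsto> \<omega> x preserves the Mahler measure).\<close>
definition n_fun :: "complex \<Rightarrow> real" where
  "n_fun t = mahler2 (\<lambda>x y. x^3 + y^3 + 1 - (3 / (t powr (1/3))) * x * y)"

definition g_fun :: "complex \<Rightarrow> real" where
  "g_fun t = mahler2 (\<lambda>x y. (x + y) * (x + 1) * (y + 1) - (1 / t) * x * y)"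

end

theory Submission
  imports Defs "HOL-Complex_Analysis.Complex_Analysis" "HOL-Probability.Probability_Measure"
begin

text \<open>
  Expanding the logarithm in the integrand gives, for small arguments,
  g(t) = - log |Q_A(t)| and n(27 t) = - log |Q_F(t)| / 3 with
  Q_A(t) = t exp (\<Sum>n\<ge>1. a n * t^n / n) and Q_F(t) = t exp (\<Sum>n\<ge>1. f n * t^n / n),
  where the Franel numbers a n = (\<Sum>k\<le>n. (n choose k)^3) and f n = (3n)! / n!^3 are the constant
  terms of powers of Laurent polynomials. So the two identities become multiplicative relations
  Q_A(p)^9 = Q_F(s1) * Q_F(s2)^4 and Q_F(s) * Q_A(x2)^8 = Q_A(x1) * Q_A(x3)^4
  between power series. If A and F are the generating functions of the two sequences, the
  logarithmic derivatives are t Q_A'(t) / Q_A(t) = A(t) and t Q_F'(t) / Q_F(t) = F(t), which turns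
  both relations into linear relations between values of A and F. These hold because
  A(z) = F(z^2 / (1 - 2z)^3) / (1 - 2z) = F(z / (1 + 4z)^3) / (1 + 4z)
  expresses everything by a single series: A(p) in the first relation, and
  F(u^2 (1 + u)^2 / (4 (1 + u + u^2)^3)) in the second. The three series in the formula for A solve
  the same second-order differential equation, whose power series solutions are determined by their
  constant term; for A itself this equation is Franel's recurrence.
\<close>

unbundle no vec_syntax

subsection \<open>Franel numbers\<close>

definition franel :: "nat \<Rightarrow> nat" where
  "franel n = (\<Sum>k\<le>n. (n choose k) ^ 3)"

lemma int_binomial_absorb_comp: "int n * int (n - 1 choose k) = (int n - int k) * int (n choose k)"
proof (cases "k \<le> n")
  case True
  then have "int n * int (n - 1 choose k) = int (n - k) * int (n choose k)"
    by (simp only: binomial_absorb_comp flip: of_nat_mult)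
  with True show ?thesis by (simp add: of_nat_diff)
qed (simp add: binomial_eq_0)

lemma int_binomial_Suc: "int (Suc k) * int (n choose Suc k) = (int n - int k) * int (n choose k)"
  using int_binomial_absorb_comp[of n k]
  by (simp only: binomial_absorption flip: of_nat_mult)

text \<open>Zeilberger's algorithm yields this certificate.\<close>

definition franel_certificate :: "nat \<Rightarrow> nat \<Rightarrow> int" where
  "franel_certificate n k = (int k * int (Suc n choose k)) ^ 3
      * (4 * int k ^ 3 - 6 * (3 * int n + 2) * int k ^ 2 + 3 * (int n + 1) * (9 * int n + 4) * int k
        - 2 * (int n + 1) ^ 2 * (7 * int n + 2))"

lemma franel_certificate_diff:
  "(int n + 1) ^ 3 * int n * ((int n + 1) ^ 2 * int (Suc n choose k) ^ 3
      - (7 * int n ^ 2 + 7 * int n + 2) * int (n choose k) ^ 3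
      - 8 * int n ^ 2 * int (n - 1 choose k) ^ 3)
    = franel_certificate n (Suc k) - franel_certificate n k"
proof -
  define x where "x = int (Suc n choose k)"
  define y where "y = int (n choose k)"
  define z where "z = int (n - 1 choose k)"
  have absorb_y: "(int n + 1) * y = (int n + 1 - int k) * x"
    and absorb_z: "int n * z = (int n - int k) * y"
    using int_binomial_absorb_comp[of "Suc n" k] int_binomial_absorb_comp[of n k]
    by (simp_all add: x_def y_def z_def add.commute)
  have absorb_z_twice: "(int n + 1) * int n * z = (int n - int k) * (int n + 1 - int k) * x"
    using absorb_y absorb_z by algebra
  have "(int n + 1) ^ 3 * int n * ((int n + 1) ^ 2 * x ^ 3 - (7 * int n ^ 2 + 7 * int n + 2) * y ^ 3
        - 8 * int n ^ 2 * z ^ 3)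
     = (int n + 1) ^ 5 * int n * x ^ 3
        - (7 * int n ^ 2 + 7 * int n + 2) * int n * ((int n + 1) * y) ^ 3
        - 8 * ((int n + 1) * int n * z) ^ 3"
    by algebra
  also have "\<dots> = franel_certificate n (Suc k) - franel_certificate n k"
    unfolding absorb_y absorb_z_twice franel_certificate_def int_binomial_Suc x_def[symmetric]
    unfolding of_nat_Suc
    by algebra
  finally show ?thesis
    unfolding x_def y_def z_def .
qed

lemma franel_eq_sum: "n \<le> m \<Longrightarrow> franel n = (\<Sum>k\<le>m. (n choose k) ^ 3)"
  unfolding franel_def by (intro sum.mono_neutral_left) auto

text \<open>For \<open>n = 0\<close> the truncated \<open>n - 1\<close> is harmless, because its coefficient vanishes.\<close>

lemma franel_recurrence:
  "Suc n ^ 2 * franel (Suc n) = (7 * n ^ 2 + 7 * n + 2) * franel n + 8 * n ^ 2 * franel (n - 1)"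
proof (cases "n = 0")
  case False
  have franel: "int (franel m) = (\<Sum>k\<le>Suc n. int (m choose k) ^ 3)" if "m \<le> Suc n" for m
    using franel_eq_sum[OF that] by simp
  have "(int n + 1) ^ 3 * int n * ((int n + 1) ^ 2 * int (franel (Suc n))
      - (7 * int n ^ 2 + 7 * int n + 2) * int (franel n) - 8 * int n ^ 2 * int (franel (n - 1)))
    = (\<Sum>k\<le>Suc n. franel_certificate n (Suc k) - franel_certificate n k)"
    unfolding franel_certificate_diff[symmetric]
    by (simp only: franel le_refl le_SucI diff_le_self right_diff_distrib sum_subtractf
        sum_distrib_left)
  also have "\<dots> = franel_certificate n (Suc (Suc n)) - franel_certificate n 0"
    by (simp only: sum_lessThan_telescope flip: lessThan_Suc_atMost)
  also have "\<dots> = 0"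
    by (simp add: franel_certificate_def binomial_eq_0)
  finally have "(int n + 1) ^ 2 * int (franel (Suc n))
      - (7 * int n ^ 2 + 7 * int n + 2) * int (franel n) - 8 * int n ^ 2 * int (franel (n - 1)) = 0"
    using False by simp
  then have "int (Suc n ^ 2 * franel (Suc n))
      = int ((7 * n ^ 2 + 7 * n + 2) * franel n + 8 * n ^ 2 * franel (n - 1))"
    by (simp add: algebra_simps)
  then show ?thesis by (simp only: of_nat_eq_iff)
qed (simp add: franel_def)

subsection \<open>Pullback of Sturm--Liouville equations\<close>

lemma sturm_liouville_pullback:
  fixes F S w p q P Q :: "'a::idom fps"
  assumes ode: "fps_deriv (p * fps_deriv F) = q * F" and S: "S $ 0 = 0"
    and leading: "P * w ^ 2 * fps_deriv S = fps_const c * (p oo S)"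
    and potential: "w * fps_deriv (P * fps_deriv w) + fps_const c * (q oo S) * fps_deriv S
      = Q * w ^ 2"
    and "w \<noteq> 0"
  shows "fps_deriv (P * fps_deriv (w * (F oo S))) = Q * (w * (F oo S))"
proof -
  define f where "f = F oo S"
  have deriv_f: "fps_deriv f = (fps_deriv F oo S) * fps_deriv S"
    unfolding f_def using S by (rule fps_compose_deriv)
  have "fps_deriv ((p oo S) * (fps_deriv F oo S)) = fps_deriv ((p * fps_deriv F) oo S)"
    using S by (simp add: fps_compose_mult_distrib)
  also have "\<dots> = ((q * F) oo S) * fps_deriv S"
    unfolding fps_compose_deriv[OF S] ode ..
  also have "\<dots> = (q oo S) * f * fps_deriv S"
    using S by (simp add: fps_compose_mult_distrib f_def)
  finally have deriv_pull: "fps_deriv ((p oo S) * (fps_deriv F oo S)) = (q oo S) * f * fps_deriv S" .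
  have "P * w ^ 2 * fps_deriv f = fps_const c * ((p oo S) * (fps_deriv F oo S))"
    unfolding deriv_f using leading by (simp add: mult_ac)
  then have flux: "fps_deriv (P * w ^ 2 * fps_deriv f) = fps_const c * ((q oo S) * f * fps_deriv S)"
    by (simp only: fps_deriv_mult_const_left deriv_pull)
  txt \<open>Multiplication by \<open>w\<close> completes the first-order terms to the pullback of \<open>p * fps_deriv F\<close>.\<close>
  have "w * fps_deriv (P * fps_deriv (w * f))
      = w * fps_deriv (P * fps_deriv w) * f + fps_deriv (P * w ^ 2 * fps_deriv f)"
    by (simp add: power2_eq_square algebra_simps)
  also have "\<dots> = w * (Q * (w * f))"
    unfolding flux using potential by algebra
  finally show ?thesis using \<open>w \<noteq> 0\<close> by (simp add: f_def)
qed

definition franel_fps :: "'a::field_char_0 fps" where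
  "franel_fps = Abs_fps (\<lambda>n. of_nat (franel n))"

definition trinomial_fps :: "'a::field_char_0 fps" where
  "trinomial_fps = Abs_fps (\<lambda>n. fact (3 * n) / fact n ^ 3)"

lemma franel_fps_nth_0 [simp]: "franel_fps $ 0 = 1"
  by (simp add: franel_fps_def franel_def)

lemma trinomial_fps_nth_0 [simp]: "trinomial_fps $ 0 = 1"
  by (simp add: trinomial_fps_def)

definition franel_ode :: "'a::field_char_0 fps \<Rightarrow> bool" where
  "franel_ode H \<longleftrightarrow>
    fps_deriv (fps_X * (1 + fps_X) * (1 - 8 * fps_X) * fps_deriv H) = (2 + 8 * fps_X) * H"

lemma franel_ode_iff:
  "franel_ode H \<longleftrightarrow> (\<forall>n. of_nat (Suc n) ^ 2 * H $ Suc n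
    = (7 * of_nat n ^ 2 + 7 * of_nat n + 2) * H $ n + 8 * of_nat n ^ 2 * H $ (n - 1))"
  (is "_ \<longleftrightarrow> (\<forall>n. ?l n = ?r n)")
proof -
  define D where "D = fps_deriv (fps_X * (1 + fps_X) * (1 - 8 * fps_X) * fps_deriv H)
    - (2 + 8 * fps_X) * H"
  have "fps_X * (1 + fps_X) * (1 - 8 * fps_X) * fps_deriv H
    = fps_X * (fps_deriv H - fps_const 7 * (fps_X * fps_deriv H)
        - fps_const 8 * (fps_X * (fps_X * fps_deriv H)))"
    by (simp add: numeral_fps_const[symmetric] algebra_simps)
  then have "D $ n = ?l n - ?r n" for n
    unfolding D_def
    by (cases n; cases "n - 1"; cases "n - 2")
       (simp_all add: numeral_fps_const distrib_right mult.assoc algebra_simps power2_eq_square)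
  then have "D = 0 \<longleftrightarrow> (\<forall>n. ?l n = ?r n)"
    by (simp add: fps_eq_iff)
  then show ?thesis by (simp add: D_def franel_ode_def)
qed

lemma franel_ode_franel_fps: "franel_ode franel_fps"
  unfolding franel_ode_iff franel_fps_def fps_nth_Abs_fps
proof
  fix n
  show "of_nat (Suc n) ^ 2 * (of_nat (franel (Suc n)) :: 'a)
    = (7 * of_nat n ^ 2 + 7 * of_nat n + 2) * of_nat (franel n)
      + 8 * of_nat n ^ 2 * of_nat (franel (n - 1))"
    using arg_cong[OF franel_recurrence[of n], of "of_nat :: nat \<Rightarrow> 'a"]
    by (simp only: of_nat_mult of_nat_power of_nat_add of_nat_numeral)
qed

lemma franel_ode_unique:
  assumes G: "franel_ode G" and H: "franel_ode H" and "G $ 0 = H $ 0"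
  shows "G = H"
proof (rule fps_ext)
  fix n
  show "G $ n = H $ n"
  proof (induction n rule: less_induct)
    case (less n)
    show ?case
    proof (cases n)
      case (Suc m)
      have "of_nat (Suc m) ^ 2 * G $ Suc m = of_nat (Suc m) ^ 2 * H $ Suc m"
        using G H less Suc unfolding franel_ode_iff by simp
      then show ?thesis using Suc by (simp del: of_nat_Suc)
    qed (use assms in simp)
  qed
qed

lemma trinomial_fps_nth_Suc:
  "of_nat (Suc n) ^ 2 * trinomial_fps $ Suc n
    = (3 * (3 * of_nat n + 1) * (3 * of_nat n + 2) * trinomial_fps $ n :: 'a::field_char_0)"
proof -
  have "3 * Suc n = Suc (Suc (Suc (3 * n)))" by simp
  then have fact: "fact (3 * Suc n)
      = (3 * (of_nat n + 1)) * (3 * of_nat n + 2) * (3 * of_nat n + 1) * (fact (3 * n) :: 'a)"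
    by (simp only: fact_Suc) (simp add: algebra_simps)
  have "(of_nat n + 1 :: 'a) \<noteq> 0" by (metis of_nat_Suc of_nat_neq_0 add.commute)
  then show ?thesis
    unfolding trinomial_fps_def fps_nth_Abs_fps fact fact_Suc of_nat_Suc
    by (simp add: divide_simps power3_eq_cube power2_eq_square) (simp add: algebra_simps)
qed

lemma trinomial_fps_ode:
  "fps_deriv (fps_X * (1 - 27 * fps_X) * fps_deriv trinomial_fps)
    = (6 * trinomial_fps :: 'a::field_char_0 fps)"
proof (rule fps_ext)
  fix n
  let ?F = "trinomial_fps :: 'a fps"
  have "fps_X * (1 - 27 * fps_X) * fps_deriv ?F
      = fps_X * (fps_deriv ?F - fps_const 27 * (fps_X * fps_deriv ?F))"
    by (simp add: numeral_fps_const[symmetric] algebra_simps)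
  then show "fps_deriv (fps_X * (1 - 27 * fps_X) * fps_deriv ?F) $ n = (6 * ?F) $ n"
    using trinomial_fps_nth_Suc[of n, where ?'a = 'a]
    by (cases n) (simp_all add: numeral_fps_const power2_eq_square algebra_simps)
qed

lemma fps_deriv_of_inverse:
  assumes "w * b = (1 :: 'a::idom fps)"
  shows "fps_deriv w = - fps_deriv b * w ^ 2"
proof -
  have "fps_deriv w * b + w * fps_deriv b = 0"
    using arg_cong[OF assms, of fps_deriv] by (simp add: add.commute)
  with assms show ?thesis by algebra
qed

lemma franel_ode_cubic_pullback:
  assumes w: "w * (1 + 4 * fps_X) = (1 :: 'a::field_char_0 fps)"
  shows "franel_ode (w * (trinomial_fps oo (fps_X * w ^ 3)))"
  unfolding franel_ode_def
proof (rule sturm_liouville_pullback[OF trinomial_fps_ode, where c = 1])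
  let ?S = "fps_X * w ^ 3" and ?P = "fps_X * (1 + fps_X) * (1 - 8 * fps_X)"
  have deriv_w: "fps_deriv w = - 4 * w ^ 2"
    using fps_deriv_of_inverse[OF w] by simp
  have deriv_S: "fps_deriv ?S = (1 - 8 * fps_X) * w ^ 4"
    by (simp add: fps_deriv_power deriv_w eval_nat_numeral) (use w in algebra)
  have compose_S: "fps_X * (1 - 27 * fps_X) oo ?S = ?S * (1 - 27 * ?S)"
    by (simp add: fps_compose_mult_distrib fps_compose_sub_distrib)
  have one_minus_27_S: "1 - 27 * ?S = (1 + fps_X) * (1 - 8 * fps_X) ^ 2 * w ^ 3"
    using w by algebra
  show "?P * w ^ 2 * fps_deriv ?S = fps_const 1 * (fps_X * (1 - 27 * fps_X) oo ?S)"
    unfolding compose_S deriv_S one_minus_27_S by simp algebra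
  have "fps_deriv (?P * fps_deriv w)
      = - 4 * (1 - 14 * fps_X - 24 * fps_X ^ 2) * w ^ 2 + 32 * ?P * w ^ 3"
    unfolding deriv_w by (simp add: fps_deriv_power deriv_w eval_nat_numeral) algebra
  then show "w * fps_deriv (?P * fps_deriv w) + fps_const 1 * (6 oo ?S) * fps_deriv ?S
      = (2 + 8 * fps_X) * w ^ 2"
    unfolding deriv_S using w by simp algebra
qed (use w in auto)

lemma franel_ode_macmahon_pullback:
  assumes w: "w * (1 - 2 * fps_X) = (1 :: 'a::field_char_0 fps)"
  shows "franel_ode (w * (trinomial_fps oo (fps_X ^ 2 * w ^ 3)))"
  unfolding franel_ode_def
proof (rule sturm_liouville_pullback[OF trinomial_fps_ode, where c = 2])
  let ?S = "fps_X ^ 2 * w ^ 3" and ?P = "fps_X * (1 + fps_X) * (1 - 8 * fps_X)"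
  have deriv_w: "fps_deriv w = 2 * w ^ 2"
    using fps_deriv_of_inverse[OF w] by simp
  have deriv_S: "fps_deriv ?S = 2 * fps_X * (1 + fps_X) * w ^ 4"
    by (simp add: fps_deriv_power deriv_w eval_nat_numeral) (use w in algebra)
  have compose_S: "fps_X * (1 - 27 * fps_X) oo ?S = ?S * (1 - 27 * ?S)"
    by (simp add: fps_compose_mult_distrib fps_compose_sub_distrib)
  have one_minus_27_S: "1 - 27 * ?S = (1 + fps_X) ^ 2 * (1 - 8 * fps_X) * w ^ 3"
    using w by algebra
  show "?P * w ^ 2 * fps_deriv ?S = fps_const 2 * (fps_X * (1 - 27 * fps_X) oo ?S)"
    unfolding compose_S deriv_S one_minus_27_S by (simp add: numeral_fps_const[symmetric]) algebra
  have "fps_deriv (?P * fps_deriv w)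
      = 2 * (1 - 14 * fps_X - 24 * fps_X ^ 2) * w ^ 2 + 8 * ?P * w ^ 3"
    unfolding deriv_w by (simp add: fps_deriv_power deriv_w eval_nat_numeral)
  then show "w * fps_deriv (?P * fps_deriv w) + fps_const 2 * (6 oo ?S) * fps_deriv ?S
      = (2 + 8 * fps_X) * w ^ 2"
    unfolding deriv_S using w by (simp add: numeral_fps_const[symmetric]) algebra
qed (use w in auto)

lemma fps_compose_eq_if_mult_eq_1:
  fixes P v w b :: "'a::idom fps"
  assumes "P $ 0 = 0" "w * b = 1" "v * (b oo P) = 1"
  shows "w oo P = v"
proof -
  have "(w oo P) * (b oo P) = 1"
    using assms(1,2) by (simp flip: fps_compose_mult_distrib)
  with assms(3) show ?thesis by algebra
qed

lemma fps_mult_compose_compose: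
  fixes P :: "'a::field fps"
  assumes "P $ 0 = 0" "S $ 0 = 0"
  shows "(w * (F oo (S * w ^ n))) oo P = (w oo P) * (F oo ((S oo P) * (w oo P) ^ n))"
  using assms
  by (simp add: fps_compose_mult_distrib fps_compose_power flip: fps_compose_assoc)

lemma franel_fps_eq_compose_cubic:
  fixes P v :: "'a::field_char_0 fps"
  assumes P: "P $ 0 = 0" and v: "v * (1 + 4 * P) = 1"
  shows "franel_fps oo P = v * (trinomial_fps oo (P * v ^ 3))"
proof -
  define w :: "'a fps" where "w = inverse (1 + 4 * fps_X)"
  have w: "w * (1 + 4 * fps_X) = 1"
    unfolding w_def by (rule inverse_mult_eq_1) simp
  have franel: "franel_fps = w * (trinomial_fps oo (fps_X * w ^ 3))"
    using franel_ode_franel_fps franel_ode_cubic_pullback[OF w]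
    by (rule franel_ode_unique) (simp add: w_def)
  have "w oo P = v"
    using P w by (rule fps_compose_eq_if_mult_eq_1)
      (simp add: fps_compose_add_distrib fps_compose_mult_distrib P v)
  then show ?thesis
    unfolding franel using P by (simp add: fps_mult_compose_compose)
qed

lemma franel_fps_eq_compose_macmahon:
  fixes P v :: "'a::field_char_0 fps"
  assumes P: "P $ 0 = 0" and v: "v * (1 - 2 * P) = 1"
  shows "franel_fps oo P = v * (trinomial_fps oo (P ^ 2 * v ^ 3))"
proof -
  define w :: "'a fps" where "w = inverse (1 - 2 * fps_X)"
  have w: "w * (1 - 2 * fps_X) = 1"
    unfolding w_def by (rule inverse_mult_eq_1) simp
  have franel: "franel_fps = w * (trinomial_fps oo (fps_X ^ 2 * w ^ 3))"
    using franel_ode_franel_fps franel_ode_macmahon_pullback[OF w]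
    by (rule franel_ode_unique) (simp add: w_def)
  have "w oo P = v"
    using P w by (rule fps_compose_eq_if_mult_eq_1)
      (simp add: fps_compose_sub_distrib fps_compose_mult_distrib P v)
  then show ?thesis
    unfolding franel using P by (simp add: fps_mult_compose_compose fps_X_power_compose)
qed

subsection \<open>Logarithmic derivatives\<close>

definition has_log_deriv :: "'a::field_char_0 fps \<Rightarrow> 'a fps \<Rightarrow> bool" where
  "has_log_deriv f d \<longleftrightarrow> fps_X * fps_deriv f = d * f"

lemma has_log_deriv_mult:
  "has_log_deriv f d \<Longrightarrow> has_log_deriv g e \<Longrightarrow> has_log_deriv (f * g) (d + e)"
  unfolding has_log_deriv_def fps_deriv_mult by algebra

lemma has_log_deriv_power:
  "has_log_deriv f d \<Longrightarrow> has_log_deriv (f ^ n) (of_nat n * d)"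
proof (induction n)
  case (Suc n)
  then show ?case
    using has_log_deriv_mult[of f d "f ^ n" "of_nat n * d"] by (simp add: algebra_simps)
qed (simp add: has_log_deriv_def)

lemma has_log_deriv_nth_0:
  assumes "has_log_deriv f d" "f \<noteq> 0"
  shows "d $ 0 = of_nat (subdegree f)"
proof -
  define k where "k = subdegree f"
  have "of_nat k * f $ k = (fps_X * fps_deriv f) $ k"
    by (cases k) simp_all
  also have "\<dots> = (d * f) $ k"
    using assms(1) by (simp only: has_log_deriv_def)
  also have "\<dots> = d $ 0 * f $ k"
    unfolding fps_mult_nth_conv_upto_subdegree_right k_def by simp
  finally show ?thesis
    using assms(2) by (simp add: k_def)
qed

definition has_leading_term :: "'a::comm_ring_1 fps \<Rightarrow> nat \<Rightarrow> 'a \<Rightarrow> bool" where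
  "has_leading_term f m c \<longleftrightarrow> (\<exists>u. f = fps_X ^ m * u \<and> u $ 0 = c)"

lemma has_leading_termI: "f = fps_X ^ m * u \<Longrightarrow> u $ 0 = c \<Longrightarrow> has_leading_term f m c"
  by (auto simp: has_leading_term_def)

lemma has_leading_term_nth: "has_leading_term f m c \<Longrightarrow> f $ m = c"
  by (auto simp: has_leading_term_def fps_X_power_mult_nth)

lemma has_leading_term_nth_0: "has_leading_term f m c \<Longrightarrow> 0 < m \<Longrightarrow> f $ 0 = 0"
  by (auto simp: has_leading_term_def)

lemma has_leading_term_subdegree: "has_leading_term f m c \<Longrightarrow> c \<noteq> 0 \<Longrightarrow> subdegree f = m"
  by (intro subdegreeI) (auto simp: has_leading_term_def fps_X_power_mult_nth)

lemma has_leading_term_mult: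
  assumes "has_leading_term f m a" "has_leading_term g n b"
  shows "has_leading_term (f * g) (m + n) (a * b)"
proof -
  obtain u v where "f = fps_X ^ m * u" "u $ 0 = a" "g = fps_X ^ n * v" "v $ 0 = b"
    using assms by (auto simp: has_leading_term_def)
  then have "f * g = fps_X ^ (m + n) * (u * v)" "(u * v) $ 0 = a * b"
    by (simp_all add: power_add mult_ac)
  then show ?thesis unfolding has_leading_term_def by blast
qed

lemma has_leading_term_power:
  assumes "has_leading_term f m a"
  shows "has_leading_term (f ^ n) (n * m) (a ^ n)"
proof -
  obtain u where "f = fps_X ^ m * u" "u $ 0 = a"
    using assms by (auto simp: has_leading_term_def)
  then have "f ^ n = fps_X ^ (n * m) * u ^ n" "(u ^ n) $ 0 = a ^ n"
    by (simp_all add: power_mult_distrib power_mult[symmetric] fps_nth_power_0 mult.commute)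
  then show ?thesis unfolding has_leading_term_def by blast
qed

lemma has_log_deriv_unique:
  assumes f: "has_log_deriv f d" and g: "has_log_deriv g d"
    and lead: "has_leading_term f m c" "has_leading_term g m c" "c \<noteq> 0"
  shows "f = g"
proof (rule ccontr)
  assume "f \<noteq> g"
  have "has_log_deriv (f - g) d"
    using f g by (simp add: has_log_deriv_def algebra_simps)
  then have "d $ 0 = of_nat (subdegree (f - g))"
    using \<open>f \<noteq> g\<close> by (simp add: has_log_deriv_nth_0)
  moreover have "d $ 0 = of_nat m"
    using has_log_deriv_nth_0[OF f] has_leading_term_subdegree[OF lead(1,3)]
      has_leading_term_nth[OF lead(1)] lead(3)
    by auto
  ultimately have "subdegree (f - g) = m"
    by (metis of_nat_eq_iff)
  then have "(f - g) $ m \<noteq> 0"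
    using \<open>f \<noteq> g\<close> by (metis nth_subdegree_nonzero right_minus_eq)
  then show False
    using lead(1,2) by (simp add: has_leading_term_nth)
qed

definition euler_exp :: "'a::field_char_0 fps \<Rightarrow> 'a fps" where
  "euler_exp F = fps_X * (fps_exp 1 oo fps_integral0 (fps_shift 1 F))"

lemma has_log_deriv_euler_exp:
  assumes "F $ 0 = 1"
  shows "has_log_deriv (euler_exp F) F"
proof -
  define L where "L = fps_integral0 (fps_shift 1 F)"
  have "fps_X * fps_shift 1 F = F - 1"
  proof (rule fps_ext)
    fix n
    show "(fps_X * fps_shift 1 F) $ n = (F - 1) $ n"
      using assms by (cases n) simp_all
  qed
  then have "fps_X * fps_deriv L = F - 1"
    by (simp add: L_def fps_deriv_fps_integral)
  moreover have "fps_deriv (fps_exp 1 oo L) = (fps_exp 1 oo L) * fps_deriv L"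
    by (simp add: fps_compose_deriv L_def)
  ultimately show ?thesis
    unfolding has_log_deriv_def euler_exp_def L_def[symmetric] by (simp add: fps_deriv_mult) algebra
qed

lemma has_log_deriv_euler_exp_compose:
  assumes "F $ 0 = 1" and S: "S $ 0 = 0" and "has_log_deriv S d"
  shows "has_log_deriv (euler_exp F oo S) (d * (F oo S))"
proof -
  have "(fps_X * fps_deriv (euler_exp F)) oo S = (F * euler_exp F) oo S"
    using has_log_deriv_euler_exp[OF assms(1)] by (simp add: has_log_deriv_def)
  then have "S * (fps_deriv (euler_exp F) oo S) = (F oo S) * (euler_exp F oo S)"
    using S by (simp add: fps_compose_mult_distrib)
  then show ?thesis
    using assms(3) unfolding has_log_deriv_def fps_compose_deriv[OF S] by algebra
qed

lemma has_leading_term_euler_exp_compose: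
  assumes S: "has_leading_term S m c" and "0 < m"
  shows "has_leading_term (euler_exp F oo S) m c"
proof -
  let ?E = "fps_exp 1 oo fps_integral0 (fps_shift 1 F) oo S"
  have "euler_exp F oo S = S * ?E"
    using has_leading_term_nth_0[OF assms] by (simp add: euler_exp_def fps_compose_mult_distrib)
  moreover have "has_leading_term ?E 0 1"
    by (rule has_leading_termI[where u = ?E]) simp_all
  ultimately show ?thesis
    using has_leading_term_mult[OF S] by fastforce
qed

lemma has_leading_term_X_power: "has_leading_term (fps_X ^ m) m 1"
  by (rule has_leading_termI[where u = 1]) simp_all

lemma has_leading_term_euler_exp: "has_leading_term (euler_exp F) 1 1"
  using has_leading_term_euler_exp_compose[OF has_leading_term_X_power[of 1]] by simp

lemma euler_exp_compose_X_power:
  fixes F :: "'a::field_char_0 fps"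
  assumes F: "F $ 0 = 1" and k: "0 < k"
  shows "euler_exp (F oo fps_X ^ k) ^ k = euler_exp F oo fps_X ^ k"
proof (rule has_log_deriv_unique)
  have X: "has_log_deriv (fps_X ^ k) (of_nat k * 1 :: 'a fps)"
    by (rule has_log_deriv_power) (simp add: has_log_deriv_def)
  show "has_log_deriv (euler_exp (F oo fps_X ^ k) ^ k) (of_nat k * (F oo fps_X ^ k))"
    by (intro has_log_deriv_power has_log_deriv_euler_exp) (simp add: F)
  show "has_log_deriv (euler_exp F oo fps_X ^ k) (of_nat k * (F oo fps_X ^ k))"
    using has_log_deriv_euler_exp_compose[OF F _ X] k by simp
  show "has_leading_term (euler_exp F oo fps_X ^ k) k 1"
    using has_leading_term_X_power k by (rule has_leading_term_euler_exp_compose)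
  show "has_leading_term (euler_exp (F oo fps_X ^ k) ^ k) k 1"
    using has_leading_term_power[OF has_leading_term_euler_exp, of _ k] by simp
qed simp

subsection \<open>Multiplicative relations\<close>

lemma euler_exp_franel_in_terms_of_trinomial:
  fixes a b :: "'a::field_char_0 fps"
  assumes a: "a * (1 + 4 * fps_X) = 1" and b: "b * (1 - 2 * fps_X) = 1"
  defines "S \<equiv> fps_X * a ^ 3" and "T \<equiv> fps_X ^ 2 * b ^ 3"
  shows "euler_exp franel_fps ^ 9
      = (euler_exp trinomial_fps oo S) * (euler_exp trinomial_fps oo T) ^ 4"
    (is "_ = ?R")
proof (rule has_log_deriv_unique)
  show "has_log_deriv (euler_exp franel_fps ^ 9 :: 'a fps) (of_nat 9 * franel_fps)"
    by (intro has_log_deriv_power has_log_deriv_euler_exp) simp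
  have "has_log_deriv S ((1 - 8 * fps_X) * a)"
    unfolding has_log_deriv_def S_def
    by (simp add: fps_deriv_power fps_deriv_of_inverse[OF a] eval_nat_numeral) (use a in algebra)
  moreover have "has_log_deriv T (2 * (1 + fps_X) * b)"
    unfolding has_log_deriv_def T_def
    by (simp add: fps_deriv_power fps_deriv_of_inverse[OF b] eval_nat_numeral) (use b in algebra)
  ultimately have "has_log_deriv ?R ((1 - 8 * fps_X) * a * (trinomial_fps oo S)
      + of_nat 4 * (2 * (1 + fps_X) * b * (trinomial_fps oo T)))"
    by (intro has_log_deriv_mult has_log_deriv_power has_log_deriv_euler_exp_compose)
      (simp_all add: S_def T_def)
  also have "(1 - 8 * fps_X) * a * (trinomial_fps oo S)
        + of_nat 4 * (2 * (1 + fps_X) * b * (trinomial_fps oo T))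
      = (1 - 8 * fps_X) * franel_fps + 4 * (2 * (1 + fps_X) * franel_fps)"
    using franel_fps_eq_compose_cubic[OF _ a] franel_fps_eq_compose_macmahon[OF _ b]
    by (simp add: S_def T_def mult.assoc)
  also have "\<dots> = of_nat 9 * franel_fps"
    by (simp add: algebra_simps)
  finally show "has_log_deriv ?R (of_nat 9 * franel_fps)" .
  have "a $ 0 = 1" "b $ 0 = 1"
    using arg_cong[OF a, of "\<lambda>f. f $ 0"] arg_cong[OF b, of "\<lambda>f. f $ 0"] by simp_all
  then have "has_leading_term S 1 1" "has_leading_term T 2 1"
    unfolding S_def T_def by (auto intro!: has_leading_termI simp: fps_nth_power_0)
  then have "has_leading_term ?R (1 + 4 * 2) (1 * 1 ^ 4)"
    by (intro has_leading_term_mult has_leading_term_power has_leading_term_euler_exp_compose)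
      simp_all
  then show "has_leading_term ?R 9 1"
    by simp
  show "has_leading_term (euler_exp franel_fps ^ 9 :: 'a fps) 9 1"
    using has_leading_term_power[OF has_leading_term_euler_exp, of _ 9] by simp
qed simp

locale franel_arguments =
  fixes w q h :: "'a::field_char_0 fps"
  assumes w: "w * (1 + fps_X) = 1" and q: "q * (1 + 4 * fps_X + fps_X ^ 2) = 1" and h: "2 * h = 1"
begin

definition trinomial_arg :: "'a fps" where
  "trinomial_arg = h * fps_X * (1 + fps_X) ^ 4 * q ^ 3"

definition franel_arg1 :: "'a fps" where
  "franel_arg1 = h * fps_X * w ^ 2"

definition franel_arg2 :: "'a fps" where
  "franel_arg2 = - (h * fps_X * (1 + fps_X))"

definition franel_arg3 :: "'a fps" where
  "franel_arg3 = h ^ 2 * fps_X ^ 2 * w"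

lemma franel_fps_common_pullback:
  assumes c: "c * (1 + fps_X + fps_X ^ 2) = 1"
  defines "S \<equiv> h ^ 2 * fps_X ^ 2 * (1 + fps_X) ^ 2 * c ^ 3"
  shows "franel_fps oo franel_arg1 = (1 + fps_X) ^ 2 * c * (trinomial_fps oo S)" (is ?arg1)
    and "franel_fps oo franel_arg2 = c * (trinomial_fps oo S)" (is ?arg2)
    and "franel_fps oo franel_arg3 = (1 + fps_X) * c * (trinomial_fps oo S)" (is ?arg3)
proof -
  have S: "S = franel_arg1 ^ 2 * ((1 + fps_X) ^ 2 * c) ^ 3"
    unfolding S_def franel_arg1_def using w by algebra
  have "(1 + fps_X) ^ 2 * c * (1 - 2 * franel_arg1) = 1"
    unfolding franel_arg1_def using w c h by algebra
  then show ?arg1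
    unfolding S by (rule franel_fps_eq_compose_macmahon[rotated]) (simp add: franel_arg1_def)
  have S: "S = franel_arg2 ^ 2 * c ^ 3"
    unfolding S_def franel_arg2_def by algebra
  have "c * (1 - 2 * franel_arg2) = 1"
    unfolding franel_arg2_def using c h by algebra
  then show ?arg2
    unfolding S by (rule franel_fps_eq_compose_macmahon[rotated]) (simp add: franel_arg2_def)
  have S: "S = franel_arg3 * ((1 + fps_X) * c) ^ 3"
    unfolding S_def franel_arg3_def using w by algebra
  have "(1 + fps_X) * c * (1 + 4 * franel_arg3) = 1"
    unfolding franel_arg3_def using w c h by algebra
  then show ?arg3
    unfolding S by (rule franel_fps_eq_compose_cubic[rotated]) (simp add: franel_arg3_def)
qed

lemma trinomial_fps_common_pullback:
  assumes c: "c * (1 + fps_X + fps_X ^ 2) = 1"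
  shows "q * (trinomial_fps oo trinomial_arg)
    = c * (trinomial_fps oo (h ^ 2 * fps_X ^ 2 * (1 + fps_X) ^ 2 * c ^ 3))"
proof -
  have arg: "trinomial_arg = franel_arg1 * ((1 + fps_X) ^ 2 * q) ^ 3"
    unfolding trinomial_arg_def franel_arg1_def using w by algebra
  have "(1 + fps_X) ^ 2 * q * (1 + 4 * franel_arg1) = 1"
    unfolding franel_arg1_def using w q h by algebra
  then have "franel_fps oo franel_arg1 = (1 + fps_X) ^ 2 * q * (trinomial_fps oo trinomial_arg)"
    unfolding arg by (rule franel_fps_eq_compose_cubic[rotated]) (simp add: franel_arg1_def)
  then show ?thesis
    unfolding franel_fps_common_pullback(1)[OF c] using w by algebra
qed

lemma has_log_deriv_args:
  "has_log_deriv trinomial_arg (w * q * (1 - fps_X) ^ 3)"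
  "has_log_deriv franel_arg1 (w * (1 - fps_X))"
  "has_log_deriv franel_arg2 (w * (1 + 2 * fps_X))"
  "has_log_deriv franel_arg3 (w * (2 + fps_X))"
proof -
  have deriv_h: "fps_deriv h = 0"
    using arg_cong[OF h, of fps_deriv] by simp
  note derivs = deriv_h fps_deriv_power fps_deriv_of_inverse[OF w] fps_deriv_of_inverse[OF q]
    eval_nat_numeral
  show "has_log_deriv trinomial_arg (w * q * (1 - fps_X) ^ 3)"
    unfolding has_log_deriv_def trinomial_arg_def by (simp add: derivs) (use w q in algebra)
  show "has_log_deriv franel_arg1 (w * (1 - fps_X))"
    unfolding has_log_deriv_def franel_arg1_def by (simp add: derivs) (use w in algebra)
  show "has_log_deriv franel_arg2 (w * (1 + 2 * fps_X))"
    unfolding has_log_deriv_def franel_arg2_def by (simp add: derivs) (use w in algebra)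
  show "has_log_deriv franel_arg3 (w * (2 + fps_X))"
    unfolding has_log_deriv_def franel_arg3_def by (simp add: derivs) (use w in algebra)
qed

lemma h_nth_0: "h $ 0 \<noteq> 0" "- h $ 0 \<noteq> 0" "(h $ 0) ^ 2 \<noteq> 0"
  using arg_cong[OF h, of "\<lambda>f. f $ 0"] by (auto simp: numeral_fps_const)

lemma has_leading_term_args:
  "has_leading_term trinomial_arg 1 (h $ 0)"
  "has_leading_term franel_arg1 1 (h $ 0)"
  "has_leading_term franel_arg2 1 (- h $ 0)"
  "has_leading_term franel_arg3 2 ((h $ 0) ^ 2)"
proof -
  have nth_0: "w $ 0 = 1" "q $ 0 = 1"
    using arg_cong[OF w, of "\<lambda>f. f $ 0"] arg_cong[OF q, of "\<lambda>f. f $ 0"] by simp_all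
  show "has_leading_term trinomial_arg 1 (h $ 0)"
    by (rule has_leading_termI[where u = "h * (1 + fps_X) ^ 4 * q ^ 3"])
      (simp_all add: trinomial_arg_def nth_0 fps_nth_power_0)
  show "has_leading_term franel_arg1 1 (h $ 0)"
    by (rule has_leading_termI[where u = "h * w ^ 2"])
      (simp_all add: franel_arg1_def nth_0 fps_nth_power_0)
  show "has_leading_term franel_arg2 1 (- h $ 0)"
    by (rule has_leading_termI[where u = "- (h * (1 + fps_X))"]) (simp_all add: franel_arg2_def)
  show "has_leading_term franel_arg3 2 ((h $ 0) ^ 2)"
    by (rule has_leading_termI[where u = "h ^ 2 * w"])
      (simp_all add: franel_arg3_def nth_0 fps_nth_power_0)
qed

lemma franel_trinomial_linear_relation:
  "w * q * (1 - fps_X) ^ 3 * (trinomial_fps oo trinomial_arg)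
      + 8 * (w * (1 + 2 * fps_X) * (franel_fps oo franel_arg2))
    = w * (1 - fps_X) * (franel_fps oo franel_arg1)
      + 4 * (w * (2 + fps_X) * (franel_fps oo franel_arg3))"
proof -
  define c :: "'a fps" where "c = inverse (1 + fps_X + fps_X ^ 2)"
  have c: "c * (1 + fps_X + fps_X ^ 2) = 1"
    unfolding c_def by (rule inverse_mult_eq_1) simp
  show ?thesis
    unfolding franel_fps_common_pullback[OF c] using trinomial_fps_common_pullback[OF c] by algebra
qed

lemma euler_exp_trinomial_in_terms_of_franel:
  "(euler_exp trinomial_fps oo trinomial_arg) * (euler_exp franel_fps oo franel_arg2) ^ 8
    = (euler_exp franel_fps oo franel_arg1) * (euler_exp franel_fps oo franel_arg3) ^ 4"
  (is "?L = ?R")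
proof (rule has_log_deriv_unique)
  note log_deriv = has_log_deriv_mult has_log_deriv_power has_log_deriv_euler_exp_compose
    has_log_deriv_args
  note lead = has_leading_term_mult has_leading_term_power has_leading_term_euler_exp_compose
    has_leading_term_args
  have nth_0: "trinomial_arg $ 0 = 0" "franel_arg1 $ 0 = 0"
    "franel_arg2 $ 0 = 0" "franel_arg3 $ 0 = 0"
    using has_leading_term_args[THEN has_leading_term_nth_0] by simp_all
  show "has_log_deriv ?R (w * (1 - fps_X) * (franel_fps oo franel_arg1)
      + of_nat 4 * (w * (2 + fps_X) * (franel_fps oo franel_arg3)))"
    by (intro log_deriv) (simp_all add: nth_0)
  have "has_log_deriv ?L (w * q * (1 - fps_X) ^ 3 * (trinomial_fps oo trinomial_arg)
      + of_nat 8 * (w * (1 + 2 * fps_X) * (franel_fps oo franel_arg2)))"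
    by (intro log_deriv) (simp_all add: nth_0)
  then show "has_log_deriv ?L (w * (1 - fps_X) * (franel_fps oo franel_arg1)
      + of_nat 4 * (w * (2 + fps_X) * (franel_fps oo franel_arg3)))"
    unfolding of_nat_numeral franel_trinomial_linear_relation .
  show "(h $ 0) ^ 9 \<noteq> 0"
    using h_nth_0 by simp
  have "has_leading_term ?L (1 + 8 * 1) (h $ 0 * (- h $ 0) ^ 8)"
    by (intro lead) simp_all
  then show "has_leading_term ?L 9 ((h $ 0) ^ 9)"
    by (simp flip: power_Suc)
  have "has_leading_term ?R (1 + 4 * 2) (h $ 0 * ((h $ 0) ^ 2) ^ 4)"
    by (intro lead) simp_all
  then show "has_leading_term ?R 9 ((h $ 0) ^ 9)"
    by (simp flip: power_mult power_Suc)
qed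

end

subsection \<open>Integrals over the torus\<close>

lemma (in finite_measure) sums_integral_if_norm_bounded:
  fixes f :: "nat \<Rightarrow> 'a \<Rightarrow> 'b::{banach, second_countable_topology}"
  assumes [measurable]: "\<And>n. f n \<in> borel_measurable M"
    and bound: "\<And>n. AE x in M. norm (f n x) \<le> b n" and "summable b"
  shows "integrable M (\<lambda>x. \<Sum>n. f n x)"
    and "(\<lambda>n. integral\<^sup>L M (f n)) sums (\<integral>x. (\<Sum>n. f n x) \<partial>M)"
proof -
  have int: "integrable M (f n)" for n
    by (rule integrable_const_bound[OF bound]) simp
  have "AE x in M. \<forall>n. norm (f n x) \<le> b n"
    using bound by (simp add: AE_all_countable)
  then have pointwise: "AE x in M. summable (\<lambda>n. norm (f n x))"
    by eventually_elim (rule summable_comparison_test'[OF \<open>summable b\<close>], simp)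
  have "(\<integral>x. norm (f n x) \<partial>M) \<le> measure M (space M) * b n" for n
    using integral_mono_AE[OF integrable_norm[OF int] integrable_const bound[of n]] by simp
  then have norms: "summable (\<lambda>n. \<integral>x. norm (f n x) \<partial>M)"
    by (intro summable_comparison_test'[OF summable_mult[OF \<open>summable b\<close>]]) simp
  show "integrable M (\<lambda>x. \<Sum>n. f n x)"
    using int pointwise norms by (rule integrable_suminf)
  show "(\<lambda>n. integral\<^sup>L M (f n)) sums (\<integral>x. (\<Sum>n. f n x) \<partial>M)"
    using int pointwise norms by (rule sums_integral)
qed

lemma (in finite_measure) integral_Ln_one_minus:
  fixes q :: "'a \<Rightarrow> complex"
  assumes [measurable]: "q \<in> borel_measurable M"
    and bound: "AE x in M. cmod (q x) \<le> r" and r: "0 \<le> r" "r < 1"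
  shows "integrable M (\<lambda>x. Ln (1 - q x))"
    and "(\<lambda>n. (\<integral>x. q x ^ n \<partial>M) / of_nat n) sums - (\<integral>x. Ln (1 - q x) \<partial>M)"
proof -
  have powers: "AE x in M. cmod (q x ^ n / of_nat n) \<le> r ^ n" for n
    using bound
  proof eventually_elim
    case (elim x)
    have "cmod (q x) ^ n / real n \<le> r ^ n / 1" if "0 < n"
      using that elim r by (intro frac_le power_mono) simp_all
    then have "cmod (q x) ^ n / real n \<le> r ^ n"
      by (cases "n = 0") simp_all
    then show ?case by (simp add: norm_divide norm_power)
  qed
  have "summable (\<lambda>n. r ^ n)"
    using r by (intro summable_geometric) simp
  note series =
    sums_integral_if_norm_bounded[of "\<lambda>n x. q x ^ n / of_nat n", OF _ powers this, simplified]
  have Ln: "AE x in M. (\<Sum>n. q x ^ n / of_nat n) = - Ln (1 - q x)"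
    using bound
  proof eventually_elim
    case (elim x)
    then have "(\<lambda>n. - (q x ^ n / of_nat n)) sums Ln (1 - q x)"
      using Ln_series'[of "- q x"] r by simp
    from sums_minus[OF this] show ?case by (simp add: sums_iff)
  qed
  have "integrable M (\<lambda>x. - Ln (1 - q x))"
    using series(1) by (subst (asm) integrable_cong_AE[OF _ _ Ln]) simp_all
  then show "integrable M (\<lambda>x. Ln (1 - q x))"
    by simp
  have "(\<integral>x. (\<Sum>n. q x ^ n / of_nat n) \<partial>M) = (\<integral>x. - Ln (1 - q x) \<partial>M)"
    by (intro integral_cong_AE Ln) simp_all
  then show "(\<lambda>n. (\<integral>x. q x ^ n \<partial>M) / of_nat n) sums - (\<integral>x. Ln (1 - q x) \<partial>M)"
    using series(2) by simp
qed

definition circle_measure :: "complex measure" where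
  "circle_measure = distr (restrict_space lborel {0..1}) borel (\<lambda>t. cis (2 * pi * t))"

abbreviation torus_measure :: "(complex \<times> complex) measure" where
  "torus_measure \<equiv> circle_measure \<Otimes>\<^sub>M circle_measure"

lemma sets_circle_measure [simp, measurable_cong]: "sets circle_measure = sets borel"
  by (simp add: circle_measure_def)

lemma sets_torus_measure: "sets torus_measure = sets borel"
  unfolding borel_prod[symmetric] by (rule sets_pair_measure_cong) simp_all

lemma measurable_cis_interval [measurable]:
  "(\<lambda>t. cis (2 * pi * t)) \<in> borel_measurable (restrict_space lborel {0..1})"
  by (auto intro!: measurable_restrict_space1 borel_measurable_continuous_onI continuous_intros)

lemma prob_space_circle_measure: "prob_space circle_measure"
proof -
  have "prob_space (restrict_space lborel {0..1 :: real})"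
    by (rule prob_space_restrict_space) simp_all
  then show ?thesis
    unfolding circle_measure_def by (rule prob_space.prob_space_distr) simp
qed

lemma AE_circle_measure_norm: "AE x in circle_measure. cmod x = 1"
  unfolding circle_measure_def by (subst AE_distr_iff) simp_all

lemma set_integral_cis_eq_integral_circle:
  fixes f :: "complex \<Rightarrow> 'b::{banach, second_countable_topology}"
  assumes "f \<in> borel_measurable borel"
  shows "(LINT t:{0..1}|lborel. f (cis (2 * pi * t))) = (\<integral>x. f x \<partial>circle_measure)"
  unfolding circle_measure_def
  by (subst integral_distr)
    (use assms in \<open>simp_all add: set_lebesgue_integral_def integral_restrict_space\<close>)

interpretation circle: prob_space circle_measure
  by (rule prob_space_circle_measure)

interpretation torus: pair_prob_space circle_measure circle_measure ..

lemma AE_torus_measure_norm: "AE p in torus_measure. cmod (fst p) = 1 \<and> cmod (snd p) = 1"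
proof (rule torus.AE_pair_measure)
  show "{p \<in> space torus_measure. cmod (fst p) = 1 \<and> cmod (snd p) = 1} \<in> sets torus_measure"
    by measurable
  show "AE x in circle_measure. AE y in circle_measure. cmod (fst (x, y)) = 1 \<and> cmod (snd (x, y)) = 1"
    using AE_circle_measure_norm by eventually_elim (use AE_circle_measure_norm in simp)
qed

lemma mahler2_eq_torus_integral:
  assumes "integrable torus_measure (\<lambda>(x, y). ln (cmod (P x y)))"
  shows "mahler2 P = (\<integral>(x, y). ln (cmod (P x y)) \<partial>torus_measure)"
proof -
  have [measurable]: "(\<lambda>(x, y). ln (cmod (P x y))) \<in> borel_measurable (borel \<Otimes>\<^sub>M borel)"
    using borel_measurable_integrable[OF assms]
    by (simp add: borel_prod measurable_cong_sets[OF sets_torus_measure refl])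
  have "(LINT t:{0..1}|lborel. ln (cmod (P x (cis (2 * pi * t)))))
      = (\<integral>y. ln (cmod (P x y)) \<partial>circle_measure)" for x
    by (rule set_integral_cis_eq_integral_circle) measurable
  then have "mahler2 P
      = (LINT s:{0..1}|lborel. \<integral>y. ln (cmod (P (cis (2 * pi * s)) y)) \<partial>circle_measure)"
    unfolding mahler2_def by simp
  also have "\<dots> = (\<integral>x. \<integral>y. ln (cmod (P x y)) \<partial>circle_measure \<partial>circle_measure)"
    by (rule set_integral_cis_eq_integral_circle) measurable
  also have "\<dots> = (\<integral>(x, y). ln (cmod (P x y)) \<partial>torus_measure)"
    using torus.integral_fst'[OF assms] by simp
  finally show ?thesis .
qed

lemma integral_circle_monomial:
  "(\<integral>x. x ^ i / x ^ m \<partial>circle_measure) = (if i = m then 1 else 0)"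
proof -
  let ?a = "2 * pi * (real i - real m)"
  have "(\<integral>x. x ^ i / x ^ m \<partial>circle_measure) = (LINT t:{0..1}|lborel. cis (?a * t))"
    by (subst set_integral_cis_eq_integral_circle[symmetric])
      (simp_all add: Complex.DeMoivre algebra_simps cis_divide)
  also have "\<dots> = (if i = m then 1 else 0)"
  proof (cases "i = m")
    case False
    then have a: "?a \<noteq> 0" by simp
    have "(LINT t:{0..1}|lborel. cis (?a * t))
        = cis (?a * 1) / (\<i> * of_real ?a) - cis (?a * 0) / (\<i> * of_real ?a)"
      unfolding set_lebesgue_integral_def
    proof (rule integral_FTC_atLeastAtMost)
      fix t :: real
      have "((\<lambda>t. exp (\<i> * of_real ?a * of_real t) / (\<i> * of_real ?a)) has_vector_derivative
         exp (\<i> * of_real ?a * of_real t)) (at t within {0..1})"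
        using a by (auto intro!: derivative_eq_intros has_vector_derivative_real_field)
      then show "((\<lambda>t. cis (?a * t) / (\<i> * of_real ?a)) has_vector_derivative cis (?a * t))
          (at t within {0..1})"
        by (simp add: cis_conv_exp mult_ac)
    qed (auto intro!: continuous_intros)
    moreover have "cis (?a * 1) = 1"
      using cis_multiple_2pi[of "real i - real m"] by simp
    ultimately show ?thesis using False by simp
  qed (simp add: set_lebesgue_integral_def)
  finally show ?thesis .
qed

lemma integral_circle_poly:
  "(\<integral>x. poly p x / x ^ m \<partial>circle_measure) = coeff p m"
proof -
  have int: "integrable circle_measure (\<lambda>x. coeff p i * (x ^ i / x ^ m))" for i
  proof (rule circle.integrable_const_bound[where B = "cmod (coeff p i)"])
    show "AE x in circle_measure. cmod (coeff p i * (x ^ i / x ^ m)) \<le> cmod (coeff p i)"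
      using AE_circle_measure_norm by eventually_elim (simp add: norm_mult norm_divide norm_power)
  qed measurable
  have "(\<integral>x. poly p x / x ^ m \<partial>circle_measure)
      = (\<integral>x. (\<Sum>i\<le>degree p. coeff p i * (x ^ i / x ^ m)) \<partial>circle_measure)"
    by (simp add: poly_altdef sum_divide_distrib)
  also have "\<dots> = (\<Sum>i\<le>degree p. coeff p i * (\<integral>x. x ^ i / x ^ m \<partial>circle_measure))"
    using int by (simp only: Bochner_Integration.integral_sum integral_mult_right_zero)
  also have "\<dots> = coeff p m"
    by (simp add: integral_circle_monomial if_distrib coeff_eq_0 cong: if_cong)
  finally show ?thesis .
qed

lemma poly_poly_const_eq_poly_map_poly:
  "poly (poly P [:y:]) x = poly (map_poly (\<lambda>c. poly c x) P) (y :: 'a::comm_semiring_1)"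
  by (induction P) (simp_all add: map_poly_pCons)

lemma integral_torus_poly:
  "(\<integral>x. \<integral>y. poly (poly P [:y:]) x / (x ^ k * y ^ m) \<partial>circle_measure \<partial>circle_measure)
    = coeff (coeff P m) k"
proof -
  have "(\<integral>y. poly (poly P [:y:]) x / (x ^ k * y ^ m) \<partial>circle_measure)
      = poly (coeff P m) x / x ^ k" for x
  proof -
    have "(\<integral>y. poly (poly P [:y:]) x / (x ^ k * y ^ m) \<partial>circle_measure)
        = (\<integral>y. poly (map_poly (\<lambda>c. poly c x) P) y / y ^ m \<partial>circle_measure) / x ^ k"
      by (simp add: poly_poly_const_eq_poly_map_poly mult.commute
          flip: divide_divide_eq_left integral_divide_zero)
    then show ?thesis by (simp add: integral_circle_poly coeff_map_poly)
  qed
  then show ?thesis by (simp add: integral_circle_poly)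
qed

subsection \<open>Mahler measures of perturbed monomials\<close>

text \<open>By \<open>integral_torus_poly\<close>, the mean over the torus picks out the constant term.\<close>

definition constant_terms :: "(complex \<Rightarrow> complex \<Rightarrow> complex) \<Rightarrow> complex fps" where
  "constant_terms R = Abs_fps (\<lambda>n. \<integral>x. \<integral>y. (R x y / (x * y)) ^ n \<partial>circle_measure \<partial>circle_measure)"

lemma bounded_on_torus:
  fixes R :: "complex \<Rightarrow> complex \<Rightarrow> complex"
  assumes "continuous_on UNIV (case_prod R)"
  obtains B where "0 < B" "\<And>x y. cmod x = 1 \<Longrightarrow> cmod y = 1 \<Longrightarrow> cmod (R x y / (x * y)) \<le> B"
proof -
  have "compact (sphere 0 1 \<times> sphere 0 1 :: (complex \<times> complex) set)"
    by (intro compact_Times compact_sphere)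
  moreover have "continuous_on (sphere 0 1 \<times> sphere 0 1) (case_prod R)"
    using assms by (rule continuous_on_subset) (rule subset_UNIV)
  ultimately have "bounded (case_prod R ` (sphere 0 1 \<times> sphere 0 1))"
    by (intro compact_imp_bounded compact_continuous_image)
  then obtain B where "0 < B" and B: "\<forall>z \<in> case_prod R ` (sphere 0 1 \<times> sphere 0 1). cmod z \<le> B"
    using bounded_pos by blast
  have "cmod (R x y / (x * y)) \<le> B" if "cmod x = 1" "cmod y = 1" for x y
  proof -
    have "R x y \<in> case_prod R ` (sphere 0 1 \<times> sphere 0 1)"
      using that by (intro image_eqI[of _ _ "(x, y)"]) simp_all
    then have "cmod (R x y) \<le> B"
      using B by blast
    with that show ?thesis by (simp add: norm_divide norm_mult)
  qed
  with \<open>0 < B\<close> show ?thesis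
    by (rule that)
qed

lemma borel_measurable_torus_continuous:
  assumes "continuous_on UNIV (case_prod R)"
  shows "(\<lambda>p. R (fst p) (snd p)) \<in> borel_measurable torus_measure"
  using borel_measurable_continuous_onI[OF assms]
  by (simp add: case_prod_beta' measurable_cong_sets[OF sets_torus_measure refl])

lemma
  fixes R :: "complex \<Rightarrow> complex \<Rightarrow> complex"
  assumes cont: "continuous_on UNIV (case_prod R)"
    and bound: "\<And>x y. cmod x = 1 \<Longrightarrow> cmod y = 1 \<Longrightarrow> cmod (R x y / (x * y)) \<le> B"
  shows constant_terms_nth: "constant_terms R $ n = (\<integral>(x, y). (R x y / (x * y)) ^ n \<partial>torus_measure)"
    and norm_constant_terms_nth_le: "cmod (constant_terms R $ n) \<le> B ^ n"
proof -
  note [measurable] = borel_measurable_torus_continuous[OF cont]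
  have le: "AE p in torus_measure. cmod ((R (fst p) (snd p) / (fst p * snd p)) ^ n) \<le> B ^ n"
    using AE_torus_measure_norm
    by eventually_elim (simp add: norm_power power_mono bound)
  have int: "integrable torus_measure (\<lambda>p. (R (fst p) (snd p) / (fst p * snd p)) ^ n)"
    by (rule torus.P.integrable_const_bound[OF le]) measurable
  show "constant_terms R $ n = (\<integral>(x, y). (R x y / (x * y)) ^ n \<partial>torus_measure)"
    using torus.integral_fst'[OF int] by (simp add: constant_terms_def case_prod_unfold)
  also have "cmod \<dots> \<le> (\<integral>p. cmod ((R (fst p) (snd p) / (fst p * snd p)) ^ n) \<partial>torus_measure)"
    unfolding case_prod_unfold by (rule integral_norm_bound)
  also have "\<dots> \<le> (\<integral>p. B ^ n \<partial>torus_measure)"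
    using int le by (intro integral_mono_AE integrable_norm) simp_all
  finally show "cmod (constant_terms R $ n) \<le> B ^ n"
    by (simp add: torus.P.prob_space)
qed

lemma torus_integral_Ln_sums:
  fixes R :: "complex \<Rightarrow> complex \<Rightarrow> complex"
  assumes cont: "continuous_on UNIV (case_prod R)"
    and bound: "\<And>x y. cmod x = 1 \<Longrightarrow> cmod y = 1 \<Longrightarrow> cmod (R x y / (x * y)) \<le> B"
    and z: "cmod z * B < 1"
  shows "integrable torus_measure (\<lambda>(x, y). Ln (1 - z * (R x y / (x * y))))"
    and "(\<lambda>n. constant_terms R $ n / of_nat n * z ^ n)
      sums - (\<integral>(x, y). Ln (1 - z * (R x y / (x * y))) \<partial>torus_measure)"
proof -
  define q where "q = (\<lambda>p. z * (R (fst p) (snd p) / (fst p * snd p)))"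
  note [measurable] = borel_measurable_torus_continuous[OF cont]
  have meas: "q \<in> borel_measurable torus_measure"
    unfolding q_def by measurable
  have le: "AE p in torus_measure. cmod (q p) \<le> cmod z * B"
    using AE_torus_measure_norm unfolding q_def norm_mult
    by eventually_elim (intro mult_left_mono bound, simp_all)
  have "0 \<le> cmod (R 1 1 / (1 * 1))"
    by (rule norm_ge_zero)
  also have "\<dots> \<le> B"
    by (rule bound) simp_all
  finally have "0 \<le> cmod z * B"
    by simp
  note Ln = torus.P.integral_Ln_one_minus[OF meas le this z]
  have "(\<integral>p. q p ^ n \<partial>torus_measure) = constant_terms R $ n * z ^ n" for n
    by (simp only: q_def case_prod_unfold power_mult_distrib constant_terms_nth[OF cont bound]
        integral_mult_right_zero mult.commute[of _ "z ^ n"])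
  with Ln show "integrable torus_measure (\<lambda>(x, y). Ln (1 - z * (R x y / (x * y))))"
    "(\<lambda>n. constant_terms R $ n / of_nat n * z ^ n)
      sums - (\<integral>(x, y). Ln (1 - z * (R x y / (x * y))) \<partial>torus_measure)"
    by (simp_all only: q_def case_prod_unfold times_divide_eq_left)
qed

lemma ln_norm_minus_monomial:
  assumes "cmod x = 1" "cmod y = 1" "z \<noteq> 0" "cmod (z * (c / (x * y))) < 1"
  shows "ln (cmod (c - 1 / z * x * y)) = Re (Ln (1 - z * (c / (x * y)))) - ln (cmod z)"
proof -
  have "1 - z * (c / (x * y)) \<noteq> 0"
    using assms(4) by auto
  moreover have "c - 1 / z * x * y = - (x * y / z) * (1 - z * (c / (x * y)))"
    using assms(1-3) by (auto simp: field_simps)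
  ultimately show ?thesis
    using assms(1-3) by (simp add: norm_mult norm_divide ln_mult ln_div Re_Ln)
qed

lemma AE_ln_norm_minus_monomial:
  fixes R :: "complex \<Rightarrow> complex \<Rightarrow> complex"
  assumes bound: "\<And>x y. cmod x = 1 \<Longrightarrow> cmod y = 1 \<Longrightarrow> cmod (R x y / (x * y)) \<le> B"
    and z: "z \<noteq> 0" "cmod z * B < 1"
  shows "AE p in torus_measure. Re ((\<lambda>(x, y). Ln (1 - z * (R x y / (x * y)))) p) - ln (cmod z)
    = (\<lambda>(x, y). ln (cmod (R x y - 1 / z * x * y))) p"
  using AE_torus_measure_norm
proof eventually_elim
  case (elim p)
  then have "cmod (z * (R (fst p) (snd p) / (fst p * snd p))) \<le> cmod z * B"
    unfolding norm_mult[of z] by (intro mult_left_mono bound) simp_all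
  then have "cmod (z * (R (fst p) (snd p) / (fst p * snd p))) < 1"
    using z(2) by (rule le_less_trans)
  with elim z(1) show ?case
    unfolding case_prod_unfold by (intro ln_norm_minus_monomial[symmetric]) simp_all
qed

lemma mahler2_minus_monomial_sums:
  fixes R :: "complex \<Rightarrow> complex \<Rightarrow> complex"
  assumes cont: "continuous_on UNIV (case_prod R)"
    and bound: "\<And>x y. cmod x = 1 \<Longrightarrow> cmod y = 1 \<Longrightarrow> cmod (R x y / (x * y)) \<le> B"
    and z: "z \<noteq> 0" "cmod z * B < 1"
  shows "\<exists>S. (\<lambda>n. constant_terms R $ n / of_nat n * z ^ n) sums S
    \<and> mahler2 (\<lambda>x y. R x y - 1 / z * x * y) = - ln (cmod z) - Re S"
proof (intro exI conjI)
  define L where "L = (\<lambda>(x, y). Ln (1 - z * (R x y / (x * y))))"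
  note L = torus_integral_Ln_sums[OF cont bound z(2), folded L_def]
  show "(\<lambda>n. constant_terms R $ n / of_nat n * z ^ n) sums - integral\<^sup>L torus_measure L"
    by (rule L(2))
  note log = AE_ln_norm_minus_monomial[OF bound z, folded L_def]
  note [measurable] = borel_measurable_torus_continuous[OF cont]
  have meas: "(\<lambda>(x, y). ln (cmod (R x y - 1 / z * x * y))) \<in> borel_measurable torus_measure"
    unfolding case_prod_unfold by measurable
  have int: "integrable torus_measure (\<lambda>p. Re (L p) - ln (cmod z))"
    by (intro Bochner_Integration.integrable_diff integrable_Re L(1) torus.P.integrable_const)
  have "integrable torus_measure (\<lambda>(x, y). ln (cmod (R x y - 1 / z * x * y)))"
    using int meas log by (rule integrable_cong_AE_imp)
  then have "mahler2 (\<lambda>x y. R x y - 1 / z * x * y)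
      = (\<integral>(x, y). ln (cmod (R x y - 1 / z * x * y)) \<partial>torus_measure)"
    by (rule mahler2_eq_torus_integral)
  also have "\<dots> = (\<integral>p. Re (L p) - ln (cmod z) \<partial>torus_measure)"
    using integral_cong_AE[OF borel_measurable_integrable[OF int] meas log] by (rule sym)
  also have "\<dots> = (\<integral>p. Re (L p) \<partial>torus_measure) - ln (cmod z)"
    by (subst Bochner_Integration.integral_diff)
      (simp_all only: integrable_Re L(1) torus.P.integrable_const torus.P.prob_space
        lebesgue_integral_const scaleR_one)
  also have "(\<integral>p. Re (L p) \<partial>torus_measure) = Re (integral\<^sup>L torus_measure L)"
    using L(1) by (rule integral_Re)
  finally show "mahler2 (\<lambda>x y. R x y - 1 / z * x * y)
      = - ln (cmod z) - Re (- integral\<^sup>L torus_measure L)"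
    by simp
qed

lemma fps_conv_radius_pos_if_geometric_bound:
  fixes F :: "'a::{banach, real_normed_div_algebra} fps"
  assumes "\<And>n. norm (F $ n) \<le> B ^ n"
  shows "0 < fps_conv_radius F"
proof -
  have "0 \<le> norm (F $ 1)"
    by (rule norm_ge_zero)
  also have "\<dots> \<le> B ^ 1"
    by (rule assms)
  finally have "0 \<le> B"
    by simp
  define r where "r = 1 / (2 * (B + 1))"
  have r: "0 < r" "B * r \<le> 1 / 2"
    using \<open>0 \<le> B\<close> by (simp_all add: r_def field_simps)
  have bound: "norm (F $ n * of_real r ^ n) \<le> (1 / 2) ^ n" for n
  proof -
    have "norm (F $ n * of_real r ^ n) \<le> B ^ n * r ^ n"
      using r by (simp add: norm_mult norm_power mult_right_mono assms)
    also have "\<dots> \<le> (1 / 2) ^ n"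
      unfolding power_mult_distrib[symmetric] using r \<open>0 \<le> B\<close>
      by (intro power_mono) simp_all
    finally show ?thesis .
  qed
  have "summable (\<lambda>n. (1 / 2 :: real) ^ n)"
    by (rule summable_geometric) simp
  then have summable: "summable (\<lambda>n. F $ n * of_real r ^ n)"
    using bound by (rule summable_comparison_test'[where N = 0])
  have "0 < ereal (norm (of_real r :: 'a))"
    using r(1) by simp
  also have "\<dots> \<le> fps_conv_radius F"
    unfolding fps_conv_radius_def using summable by (rule conv_radius_geI)
  finally show ?thesis .
qed

lemma fps_conv_radius_integral0:
  fixes F :: "'a::{banach, real_normed_field} fps"
  shows "fps_conv_radius F \<le> fps_conv_radius (fps_integral0 F)"
  unfolding fps_conv_radius_def
proof (rule conv_radius_geI_ex')
  fix r :: real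
  assume r: "0 < r" "ereal r < conv_radius (($) F)"
  then have "summable (\<lambda>n. norm (F $ n * of_real r ^ n) * r)"
    by (intro summable_mult2 abs_summable_in_conv_radius) simp
  moreover have "norm (fps_integral0 F $ Suc n * of_real r ^ Suc n)
      \<le> norm (F $ n * of_real r ^ n) * r" for n
  proof -
    have "norm (fps_integral0 F $ Suc n * of_real r ^ Suc n)
        = inverse (real (Suc n)) * (norm (F $ n * of_real r ^ n) * r)"
      using r(1) by (simp add: norm_mult norm_inverse norm_power mult_ac del: of_nat_Suc)
    also have "\<dots> \<le> 1 * (norm (F $ n * of_real r ^ n) * r)"
      using r(1) by (intro mult_right_mono) (simp_all add: field_simps)
    finally show ?thesis by simp
  qed
  ultimately have "summable (\<lambda>n. fps_integral0 F $ Suc n * of_real r ^ Suc n)"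
    by (rule summable_comparison_test'[where N = 0])
  then show "summable (\<lambda>n. fps_integral0 F $ n * of_real r ^ n)"
    by (subst (asm) summable_Suc_iff)
qed

lemma has_fps_expansion_euler_exp:
  fixes F :: "complex fps"
  assumes "0 < fps_conv_radius F"
  shows "(\<lambda>z. z * exp (eval_fps (fps_integral0 (fps_shift 1 F)) z)) has_fps_expansion euler_exp F"
proof -
  have "0 < fps_conv_radius (fps_integral0 (fps_shift 1 F))"
    using assms fps_conv_radius_integral0[of "fps_shift 1 F"] by simp
  then have "(exp \<circ> eval_fps (fps_integral0 (fps_shift 1 F))) has_fps_expansion
      (fps_exp 1 oo fps_integral0 (fps_shift 1 F))"
    by (intro has_fps_expansion_compose has_fps_expansion_exp1 eval_fps_has_fps_expansion) simp_all
  from has_fps_expansion_mult[OF has_fps_expansion_fps_X this] show ?thesis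
    by (simp add: euler_exp_def o_def)
qed

lemma eval_euler_exp_has_fps_expansion:
  fixes F :: "complex fps"
  assumes "0 < fps_conv_radius F"
  shows "eval_fps (euler_exp F) has_fps_expansion euler_exp F"
  using has_fps_expansion_euler_exp[OF assms]
  by (intro eval_fps_has_fps_expansion) (simp add: has_fps_expansion_def)

lemma fps_conv_radius_constant_terms:
  assumes "continuous_on UNIV (case_prod R)"
  shows "0 < fps_conv_radius (constant_terms R)"
proof -
  obtain B where "\<And>x y. cmod x = 1 \<Longrightarrow> cmod y = 1 \<Longrightarrow> cmod (R x y / (x * y)) \<le> B"
    using bounded_on_torus[OF assms] by metis
  from norm_constant_terms_nth_le[OF assms this] show ?thesis
    by (rule fps_conv_radius_pos_if_geometric_bound)
qed

lemma eventually_mahler2_minus_monomial: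
  fixes R :: "complex \<Rightarrow> complex \<Rightarrow> complex"
  assumes cont: "continuous_on UNIV (case_prod R)"
  shows "\<forall>\<^sub>F z in at 0. mahler2 (\<lambda>x y. R x y - 1 / z * x * y)
    = - ln (cmod (eval_fps (euler_exp (constant_terms R)) z))"
proof -
  obtain B where "0 < B"
    and bound: "\<And>x y. cmod x = 1 \<Longrightarrow> cmod y = 1 \<Longrightarrow> cmod (R x y / (x * y)) \<le> B"
    using bounded_on_torus[OF cont] by metis
  define L where "L = fps_integral0 (fps_shift 1 (constant_terms R))"
  have nth: "L $ n = constant_terms R $ n / of_nat n" for n
    by (cases n) (simp_all add: L_def divide_inverse mult.commute)
  have "\<forall>\<^sub>F z in nhds 0. eval_fps (euler_exp (constant_terms R)) z = z * exp (eval_fps L z)"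
    using has_fps_expansion_euler_exp[OF fps_conv_radius_constant_terms[OF cont]]
    by (simp add: has_fps_expansion_def L_def)
  then have "\<forall>\<^sub>F z in at 0. eval_fps (euler_exp (constant_terms R)) z = z * exp (eval_fps L z)"
    by (simp add: eventually_nhds_conv_at)
  moreover have "\<forall>\<^sub>F z in at 0. z \<in> ball 0 (1 / B) - {0}"
    using \<open>0 < B\<close> by (intro eventually_at_in_open) simp_all
  ultimately show ?thesis
  proof eventually_elim
    case (elim z)
    then have z: "z \<noteq> 0" "cmod z * B < 1"
      using \<open>0 < B\<close> by (simp_all add: field_simps)
    obtain S where S: "(\<lambda>n. constant_terms R $ n / of_nat n * z ^ n) sums S"
      and mahler: "mahler2 (\<lambda>x y. R x y - 1 / z * x * y) = - ln (cmod z) - Re S"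
      using mahler2_minus_monomial_sums[OF cont bound z] by blast
    have "eval_fps L z = S"
      unfolding eval_fps_def nth using S by (rule sums_unique[symmetric])
    then show ?case
      unfolding mahler elim(1) using z(1) by (simp add: norm_mult ln_mult)
  qed
qed

subsection \<open>Constant terms of the two families\<close>

lemma coeff_coeff_franel_power:
  "coeff (coeff (([:[:0, 1:], 1:] * [:1, 1:] * [:[:1, 1:]:]) ^ n) n) n
    = (of_nat (franel n) :: 'a::comm_ring_1)"
proof -
  have in_y: "coeff (([:[:0, 1:], 1:] * [:1, 1:]) ^ n) n
      = (\<Sum>i\<le>n. smult (of_nat ((n choose i) ^ 2)) (monom (1 :: 'a) (n - i)))"
  proof -
    have "coeff (([:[:0, 1:], 1:] * [:1, 1:]) ^ n) n
        = (\<Sum>i\<le>n. coeff ([:[:0, 1 :: 'a:], 1:] ^ n) i * coeff ([:1, 1:] ^ n) (n - i))"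
      by (simp only: power_mult_distrib coeff_mult)
    also have "\<dots> = (\<Sum>i\<le>n. smult (of_nat ((n choose i) ^ 2)) (monom 1 (n - i)))"
      by (intro sum.cong refl)
        (simp add: coeff_linear_poly_power binomial_symmetric[symmetric] monom_altdef
          power2_eq_square of_nat_poly)
    finally show ?thesis .
  qed
  have coeff_mult_const: "coeff (q * [:c:]) k = coeff q k * c" for q :: "'a poly poly" and c k
    by (simp add: mult.commute)
  have "coeff (coeff (([:[:0, 1:], 1:] * [:1, 1:] * [:[:1, 1:]:]) ^ n) n) n
      = coeff ((\<Sum>i\<le>n. smult (of_nat ((n choose i) ^ 2)) (monom (1 :: 'a) (n - i)))
          * [:1, 1:] ^ n) n"
    by (simp only: power_mult_distrib[of "[:[:0, 1:], 1:] * [:1, 1:]"] poly_const_pow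
        coeff_mult_const in_y)
  also have "\<dots> = (\<Sum>i\<le>n. of_nat ((n choose i) ^ 2) * coeff ([:1, 1:] ^ n) i)"
    unfolding sum_distrib_right coeff_sum
    by (intro sum.cong refl) (simp add: coeff_monom_mult)
  also have "\<dots> = of_nat (franel n)"
    by (simp add: coeff_linear_poly_power franel_def power2_eq_square power3_eq_cube)
  finally show ?thesis .
qed

lemma constant_terms_franel:
  "constant_terms (\<lambda>x y. (x + y) * (x + 1) * (y + 1)) = franel_fps"
proof (rule fps_ext)
  fix n
  define P :: "complex poly poly" where "P = [:[:0, 1:], 1:] * [:1, 1:] * [:[:1, 1:]:]"
  have "(x + y) * (x + 1) * (y + 1) = poly (poly P [:y:]) x" for x y
    by (simp add: P_def algebra_simps)
  then have "((x + y) * (x + 1) * (y + 1) / (x * y)) ^ n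
      = poly (poly (P ^ n) [:y:]) x / (x ^ n * y ^ n)" for x y
    by (simp only: power_divide power_mult_distrib[of x y] poly_power)
  then show "constant_terms (\<lambda>x y. (x + y) * (x + 1) * (y + 1)) $ n = franel_fps $ n"
    by (simp only: constant_terms_def franel_fps_def fps_nth_Abs_fps integral_torus_poly P_def
        coeff_coeff_franel_power)
qed

lemma coeff_monom_plus_const_power:
  fixes c :: "'a::comm_ring_1"
  assumes "0 < d"
  shows "coeff ((monom 1 d + [:c:]) ^ n) m
    = (if d dvd m then of_nat (n choose (m div d)) * c ^ (n - m div d) else 0)"
proof -
  have "(monom 1 d + [:c:]) ^ n = (\<Sum>k\<le>n. monom (of_nat (n choose k) * c ^ (n - k)) (d * k))"
    unfolding binomial_ring
    by (intro sum.cong refl) (simp add: monom_power poly_const_pow of_nat_poly smult_monom mult_ac)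
  then have "coeff ((monom 1 d + [:c:]) ^ n) m
      = (\<Sum>k\<le>n. if d * k = m then of_nat (n choose k) * c ^ (n - k) else 0)"
    by (simp add: coeff_sum)
  also have "\<dots> = (\<Sum>k\<le>n. if k = m div d \<and> d dvd m then of_nat (n choose k) * c ^ (n - k) else 0)"
    using assms by (intro sum.cong refl if_cong) auto
  also have "\<dots> = (if d dvd m then of_nat (n choose (m div d)) * c ^ (n - m div d) else 0)"
    by (simp add: binomial_eq_0)
  finally show ?thesis .
qed

lemma trinomial_fps_nth:
  "trinomial_fps $ n = (of_nat ((3 * n choose n) * (2 * n choose n)) :: 'a::field_char_0)"
  using binomial_fact[of n "3 * n", where ?'a = 'a] binomial_fact[of n "2 * n", where ?'a = 'a]
  by (simp add: trinomial_fps_def power3_eq_cube)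

lemma constant_terms_trinomial:
  "constant_terms (\<lambda>x y. x ^ 3 + y ^ 3 + 1) = trinomial_fps oo fps_X ^ 3"
proof (rule fps_ext)
  fix n
  define P :: "complex poly poly" where "P = (monom 1 3 + [:monom 1 3 + [:1:]:]) ^ n"
  have "((x ^ 3 + y ^ 3 + 1) / (x * y)) ^ n = poly (poly P [:y:]) x / (x ^ n * y ^ n)" for x y
    by (simp add: P_def power_mult_distrib power_divide poly_monom mult_ac add_ac)
  then have "constant_terms (\<lambda>x y. x ^ 3 + y ^ 3 + 1) $ n = coeff (coeff P n) n"
    by (simp only: constant_terms_def fps_nth_Abs_fps integral_torus_poly)
  also have "\<dots> = (trinomial_fps oo fps_X ^ 3) $ n"
    by (auto simp: P_def coeff_monom_plus_const_power fps_nth_compose_X_power trinomial_fps_nth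
        of_nat_poly mult_2 elim!: dvdE)
  finally show "constant_terms (\<lambda>x y. x ^ 3 + y ^ 3 + 1) $ n = (trinomial_fps oo fps_X ^ 3) $ n" .
qed

subsection \<open>Relations between the Mahler measures\<close>

lemma filterlim_at_0_if_has_fps_expansion:
  fixes f :: "complex \<Rightarrow> complex"
  assumes f: "f has_fps_expansion F" and lead: "has_leading_term F m c" "0 < m" "c \<noteq> 0"
  shows "filterlim f (at 0) (at 0)"
proof (rule filterlim_atI)
  have "(f \<longlongrightarrow> f 0) (at 0)"
    using has_fps_expansion_imp_continuous[OF f] by (simp add: continuous_within)
  then show "(f \<longlongrightarrow> 0) (at 0)"
    using has_fps_expansion_imp_0_eq_fps_nth_0[OF f] has_leading_term_nth_0[OF lead(1,2)] by simp
  have "F \<noteq> 0"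
    using has_leading_term_nth[OF lead(1)] lead(3) by auto
  then show "\<forall>\<^sub>F z in at 0. f z \<noteq> 0"
    using has_laurent_expansion_eventually_nonzero_iff'[OF has_laurent_expansion_fps[OF f]] by simp
qed

lemma eventually_eq_if_has_fps_expansion:
  assumes "f has_fps_expansion F" "g has_fps_expansion F"
  shows "\<forall>\<^sub>F z in at 0. f z = g z"
proof -
  have "\<forall>\<^sub>F z in nhds 0. f z = g z"
    using assms unfolding has_fps_expansion_def by (auto elim: eventually_elim2)
  then show ?thesis by (simp add: eventually_nhds_conv_at)
qed

definition franel_exp :: "complex \<Rightarrow> complex" where
  "franel_exp = eval_fps (euler_exp franel_fps)"

definition trinomial_exp :: "complex \<Rightarrow> complex" where
  "trinomial_exp = eval_fps (euler_exp trinomial_fps)"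

lemma continuous_on_franel_polynomial:
  "continuous_on UNIV (\<lambda>(x, y). (x + y) * (x + 1) * (y + 1) :: complex)"
  unfolding split_beta by (intro continuous_intros)

lemma continuous_on_trinomial_polynomial:
  "continuous_on UNIV (\<lambda>(x, y). x ^ 3 + y ^ 3 + 1 :: complex)"
  unfolding split_beta by (intro continuous_intros)

lemma franel_exp_has_fps_expansion: "franel_exp has_fps_expansion euler_exp franel_fps"
  unfolding franel_exp_def
  using fps_conv_radius_constant_terms[OF continuous_on_franel_polynomial]
  by (intro eval_euler_exp_has_fps_expansion) (simp only: constant_terms_franel)

lemma trinomial_exp_has_fps_expansion: "trinomial_exp has_fps_expansion euler_exp trinomial_fps"
  unfolding trinomial_exp_def
proof (intro eval_euler_exp_has_fps_expansion fps_conv_radius_pos_if_geometric_bound)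
  fix n
  have "(3 * n choose n) * (2 * n choose n) \<le> 2 ^ (3 * n) * 2 ^ (2 * n)"
    by (intro mult_le_mono binomial_le_pow2)
  also have "\<dots> = 32 ^ n"
    by (simp add: power_mult flip: power_mult_distrib)
  finally have "real ((3 * n choose n) * (2 * n choose n)) \<le> real (32 ^ n)"
    by (simp only: of_nat_le_iff)
  then show "cmod (trinomial_fps $ n) \<le> 32 ^ n"
    unfolding trinomial_fps_nth norm_of_nat by simp
qed

lemma eventually_g_fun: "\<forall>\<^sub>F t in at 0. g_fun t = - ln (cmod (franel_exp t))"
  using eventually_mahler2_minus_monomial[OF continuous_on_franel_polynomial]
  by (simp only: g_fun_def franel_exp_def constant_terms_franel)

lemma ln_norm_power: "ln (norm (z ^ n)) = of_nat n * ln (norm (z :: 'a::real_normed_div_algebra))"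
  by (cases "z = 0") (simp_all add: norm_power ln_realpow power_0_left)

lemma filterlim_cube_root_at_0:
  "filterlim (\<lambda>t :: complex. (27 * t) powr (1 / 3) / 3) (at 0) (at 0)"
proof (rule filterlim_atI)
  have "((\<lambda>t :: complex. cmod (27 * t) powr (1 / 3)) \<longlongrightarrow> 0) (at 0)"
    by (rule tendsto_zero_powrI) (auto intro!: tendsto_eq_intros)
  then have "((\<lambda>t :: complex. (27 * t) powr (1 / 3)) \<longlongrightarrow> 0) (at 0)"
    by (subst tendsto_norm_zero_iff[symmetric]) (simp add: norm_powr_real_powr')
  then show "((\<lambda>t :: complex. (27 * t) powr (1 / 3) / 3) \<longlongrightarrow> 0) (at 0)"
    by (rule tendsto_divide_zero)
  show "\<forall>\<^sub>F t :: complex in at 0. (27 * t) powr (1 / 3) / 3 \<noteq> 0"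
    by (simp add: eventually_at_filter)
qed

lemma eventually_n_fun: "\<forall>\<^sub>F t in at 0. n_fun (27 * t) = - ln (cmod (trinomial_exp t)) / 3"
proof -
  define \<phi> where "\<phi> = eval_fps (euler_exp (trinomial_fps oo fps_X ^ 3 :: complex fps))"
  define r :: "complex \<Rightarrow> complex" where "r = (\<lambda>t. (27 * t) powr (1 / 3) / 3)"
  have r: "filterlim r (at 0) (at 0)"
    unfolding r_def by (rule filterlim_cube_root_at_0)
  have "\<forall>\<^sub>F z in at 0. mahler2 (\<lambda>x y. x ^ 3 + y ^ 3 + 1 - 1 / z * x * y) = - ln (cmod (\<phi> z))"
    using eventually_mahler2_minus_monomial[OF continuous_on_trinomial_polynomial]
    by (simp only: \<phi>_def constant_terms_trinomial)
  from eventually_compose_filterlim[OF this r]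
  have mahler: "\<forall>\<^sub>F t in at 0. n_fun (27 * t) = - ln (cmod (\<phi> (r t)))"
    by (simp add: n_fun_def r_def)
  have "\<phi> has_fps_expansion euler_exp (trinomial_fps oo fps_X ^ 3)"
    unfolding \<phi>_def using fps_conv_radius_constant_terms[OF continuous_on_trinomial_polynomial]
    by (intro eval_euler_exp_has_fps_expansion) (simp only: constant_terms_trinomial)
  from has_fps_expansion_power[OF this, of 3]
  have "(\<lambda>z. \<phi> z ^ 3) has_fps_expansion (euler_exp trinomial_fps oo fps_X ^ 3)"
    by (simp add: euler_exp_compose_X_power)
  moreover have "(trinomial_exp \<circ> (\<lambda>z. z ^ 3)) has_fps_expansion
      (euler_exp trinomial_fps oo fps_X ^ 3)"
    by (intro has_fps_expansion_compose trinomial_exp_has_fps_expansion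
        has_fps_expansion_fps_X_power) simp
  ultimately have "\<forall>\<^sub>F z in at 0. \<phi> z ^ 3 = (trinomial_exp \<circ> (\<lambda>z. z ^ 3)) z"
    by (rule eventually_eq_if_has_fps_expansion)
  from eventually_compose_filterlim[OF this r]
  have cube: "\<forall>\<^sub>F t in at 0. \<phi> (r t) ^ 3 = trinomial_exp (r t ^ 3)"
    by simp
  have "\<forall>\<^sub>F t in at 0. r t ^ 3 = t"
    by (simp add: eventually_at_filter r_def power_divide powr_def exp_of_nat_mult[symmetric])
  with mahler cube show ?thesis
  proof eventually_elim
    case (elim t)
    then have "ln (cmod (trinomial_exp t)) = 3 * ln (cmod (\<phi> (r t)))"
      using ln_norm_power[of "\<phi> (r t)" 3] by simp
    with elim show ?case by simp
  qed
qed

lemma eventually_g_fun_compose: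
  fixes f :: "complex \<Rightarrow> complex"
  assumes "f has_fps_expansion F" "has_leading_term F m c" "0 < m" "c \<noteq> 0"
  shows "\<forall>\<^sub>F z in at 0. franel_exp (f z) \<noteq> 0 \<and> g_fun (f z) = - ln (cmod (franel_exp (f z)))"
proof -
  have "filterlim franel_exp (at 0) (at 0)"
    using franel_exp_has_fps_expansion has_leading_term_euler_exp
    by (rule filterlim_at_0_if_has_fps_expansion) simp_all
  then have "\<forall>\<^sub>F t in at 0. franel_exp t \<noteq> 0"
    by (simp add: filterlim_at)
  then have "\<forall>\<^sub>F t in at 0. franel_exp t \<noteq> 0 \<and> g_fun t = - ln (cmod (franel_exp t))"
    using eventually_g_fun by (rule eventually_conj)
  then show ?thesis
    using filterlim_at_0_if_has_fps_expansion[OF assms] by (rule eventually_compose_filterlim)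
qed

lemma eventually_n_fun_compose:
  fixes f :: "complex \<Rightarrow> complex"
  assumes "f has_fps_expansion F" "has_leading_term F m c" "0 < m" "c \<noteq> 0"
  shows "\<forall>\<^sub>F z in at 0. trinomial_exp (f z) \<noteq> 0
    \<and> n_fun (27 * f z) = - ln (cmod (trinomial_exp (f z))) / 3"
proof -
  have "filterlim trinomial_exp (at 0) (at 0)"
    using trinomial_exp_has_fps_expansion has_leading_term_euler_exp
    by (rule filterlim_at_0_if_has_fps_expansion) simp_all
  then have "\<forall>\<^sub>F t in at 0. trinomial_exp t \<noteq> 0"
    by (simp add: filterlim_at)
  then have "\<forall>\<^sub>F t in at 0. trinomial_exp t \<noteq> 0
      \<and> n_fun (27 * t) = - ln (cmod (trinomial_exp t)) / 3"
    using eventually_n_fun by (rule eventually_conj)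
  then show ?thesis
    using filterlim_at_0_if_has_fps_expansion[OF assms] by (rule eventually_compose_filterlim)
qed

lemma ln_norm_mult_power:
  fixes a b :: "'a::real_normed_div_algebra"
  assumes "a \<noteq> 0" "b \<noteq> 0"
  shows "ln (norm (a * b ^ n)) = ln (norm a) + of_nat n * ln (norm b)"
  using assms by (simp add: norm_mult ln_mult ln_norm_power)

lemma eventually_g_fun_in_terms_of_n_fun:
  "\<forall>\<^sub>F p in at 0. 3 * g_fun p
    = n_fun (27 * p / (1 + 4 * p) ^ 3) + 4 * n_fun (27 * p ^ 2 / (1 - 2 * p) ^ 3)"
proof -
  define a b :: "complex fps" where "a = inverse (1 + 4 * fps_X)" and "b = inverse (1 - 2 * fps_X)"
  define s t :: "complex \<Rightarrow> complex"
    where "s = (\<lambda>p. p * inverse (1 + 4 * p) ^ 3)" and "t = (\<lambda>p. p ^ 2 * inverse (1 - 2 * p) ^ 3)"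
  have ab: "a * (1 + 4 * fps_X) = 1" "b * (1 - 2 * fps_X) = 1"
    unfolding a_def b_def by (rule inverse_mult_eq_1; simp)+
  have s: "s has_fps_expansion fps_X * a ^ 3" and t: "t has_fps_expansion fps_X ^ 2 * b ^ 3"
    unfolding s_def t_def a_def b_def by (intro fps_expansion_intros; simp)+
  have lead: "has_leading_term (fps_X * a ^ 3) 1 1" "has_leading_term (fps_X ^ 2 * b ^ 3) 2 1"
    by (auto intro!: has_leading_termI simp: a_def b_def fps_nth_power_0)
  have "(\<lambda>p. (trinomial_exp \<circ> s) p * (trinomial_exp \<circ> t) p ^ 4)
      has_fps_expansion euler_exp franel_fps ^ 9"
    unfolding euler_exp_franel_in_terms_of_trinomial[OF ab]
    by (intro fps_expansion_intros trinomial_exp_has_fps_expansion s t) simp_all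
  from eventually_eq_if_has_fps_expansion[OF
      has_fps_expansion_power[OF franel_exp_has_fps_expansion] this]
  have "\<forall>\<^sub>F p in at 0. franel_exp p ^ 9 = trinomial_exp (s p) * trinomial_exp (t p) ^ 4"
    by simp
  moreover note eventually_g_fun
    eventually_n_fun_compose[OF s lead(1) zero_less_one one_neq_zero]
    eventually_n_fun_compose[OF t lead(2) zero_less_numeral one_neq_zero]
  ultimately have "\<forall>\<^sub>F p in at 0. 3 * g_fun p = n_fun (27 * s p) + 4 * n_fun (27 * t p)"
  proof eventually_elim
    case (elim p)
    then have "9 * ln (cmod (franel_exp p))
        = ln (cmod (trinomial_exp (s p))) + 4 * ln (cmod (trinomial_exp (t p)))"
      using ln_norm_power[of "franel_exp p" 9] by (simp add: ln_norm_mult_power)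
    with elim show ?case by simp
  qed
  then show ?thesis
    by (simp add: s_def t_def divide_inverse power_inverse mult.assoc)
qed

locale complex_franel_arguments = franel_arguments w q h for w q h :: "complex fps"
begin

lemma eventually_n_fun_in_terms_of_g_fun_args:
  assumes s: "s has_fps_expansion trinomial_arg" and p1: "p1 has_fps_expansion franel_arg1"
    and p2: "p2 has_fps_expansion franel_arg2" and p3: "p3 has_fps_expansion franel_arg3"
  shows "\<forall>\<^sub>F u in at 0. 3 * n_fun (27 * s u) = g_fun (p1 u) - 8 * g_fun (p2 u) + 4 * g_fun (p3 u)"
proof -
  note args = s p1 p2 p3 has_leading_term_args[THEN has_leading_term_nth_0]
  have "(\<lambda>u. (trinomial_exp \<circ> s) u * (franel_exp \<circ> p2) u ^ 8) has_fps_expansion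
      (euler_exp trinomial_fps oo trinomial_arg) * (euler_exp franel_fps oo franel_arg2) ^ 8"
    by (intro fps_expansion_intros trinomial_exp_has_fps_expansion
        franel_exp_has_fps_expansion args) simp_all
  moreover have "(\<lambda>u. (franel_exp \<circ> p1) u * (franel_exp \<circ> p3) u ^ 4) has_fps_expansion
      (euler_exp trinomial_fps oo trinomial_arg) * (euler_exp franel_fps oo franel_arg2) ^ 8"
    unfolding euler_exp_trinomial_in_terms_of_franel
    by (intro fps_expansion_intros franel_exp_has_fps_expansion args) simp_all
  ultimately have "\<forall>\<^sub>F u in at 0. (trinomial_exp \<circ> s) u * (franel_exp \<circ> p2) u ^ 8
      = (franel_exp \<circ> p1) u * (franel_exp \<circ> p3) u ^ 4"
    by (rule eventually_eq_if_has_fps_expansion)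
  moreover note eventually_n_fun_compose[OF s has_leading_term_args(1) zero_less_one h_nth_0(1)]
    eventually_g_fun_compose[OF p1 has_leading_term_args(2) zero_less_one h_nth_0(1)]
    eventually_g_fun_compose[OF p2 has_leading_term_args(3) zero_less_one h_nth_0(2)]
    eventually_g_fun_compose[OF p3 has_leading_term_args(4) zero_less_numeral h_nth_0(3)]
  ultimately show ?thesis
  proof eventually_elim
    case (elim u)
    have "ln (cmod (trinomial_exp (s u))) + 8 * ln (cmod (franel_exp (p2 u)))
        = ln (cmod (franel_exp (p1 u))) + 4 * ln (cmod (franel_exp (p3 u)))"
      using arg_cong[OF elim(1), of "\<lambda>z. ln (cmod z)"] elim(2-) by (simp add: ln_norm_mult_power)
    with elim show ?case by simp
  qed
qed

end

lemma eventually_n_fun_in_terms_of_g_fun: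
  "\<forall>\<^sub>F u in at 0. 3 * n_fun (27 * u * (1 + u) ^ 4 / (2 * (1 + 4 * u + u ^ 2) ^ 3))
    = g_fun (u / (2 * (1 + u) ^ 2)) - 8 * g_fun (- (u * (1 + u) / 2))
      + 4 * g_fun (u ^ 2 / (4 * (1 + u)))"
proof -
  define w q h :: "complex fps"
    where "w = inverse (1 + fps_X)" and "q = inverse (1 + 4 * fps_X + fps_X ^ 2)"
      and "h = fps_const (1 / 2)"
  interpret complex_franel_arguments w q h
  proof
    show "w * (1 + fps_X) = 1" "q * (1 + 4 * fps_X + fps_X ^ 2) = 1"
      unfolding w_def q_def by (rule inverse_mult_eq_1; simp)+
    show "2 * h = 1"
      by (simp add: h_def numeral_fps_const)
  qed
  define s p1 p2 p3 :: "complex \<Rightarrow> complex"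
    where "s = (\<lambda>u. 1 / 2 * u * (1 + u) ^ 4 * inverse (1 + 4 * u + u ^ 2) ^ 3)"
      and "p1 = (\<lambda>u. 1 / 2 * u * inverse (1 + u) ^ 2)"
      and "p2 = (\<lambda>u. - (1 / 2 * u * (1 + u)))"
      and "p3 = (\<lambda>u. 1 / 4 * u ^ 2 * inverse (1 + u))"
  have h_square: "h ^ 2 = fps_const (1 / 4)"
    by (simp add: h_def power2_eq_square)
  have s: "s has_fps_expansion trinomial_arg"
    and p1: "p1 has_fps_expansion franel_arg1"
    and p2: "p2 has_fps_expansion franel_arg2"
    and p3: "p3 has_fps_expansion franel_arg3"
    unfolding s_def p1_def p2_def p3_def trinomial_arg_def franel_arg1_def franel_arg2_def
      franel_arg3_def h_square unfolding w_def q_def h_def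
    by (intro fps_expansion_intros; simp)+
  from eventually_n_fun_in_terms_of_g_fun_args[OF s p1 p2 p3] show ?thesis
    by (simp only: s_def p1_def p2_def p3_def divide_inverse power_inverse inverse_mult_distrib
        mult_1_left mult_ac)
qed

theorem mainTheorem10:
  shows "(\<exists>\<epsilon>>0. \<forall>p::complex. 0 < cmod p \<and> cmod p < \<epsilon> \<longrightarrow>
            3 * g_fun p = n_fun (27 * p / (1 + 4 * p)^3) + 4 * n_fun (27 * p^2 / (1 - 2 * p)^3))
       \<and> (\<exists>\<epsilon>>0. \<forall>u::complex. 0 < cmod u \<and> cmod u < \<epsilon> \<longrightarrow>
            3 * n_fun (27 * u * (1 + u)^4 / (2 * (1 + 4 * u + u^2)^3))
              = g_fun (u / (2 * (1 + u)^2)) - 8 * g_fun (- (u * (1 + u) / 2))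
                + 4 * g_fun (u^2 / (4 * (1 + u))))"
  using eventually_g_fun_in_terms_of_n_fun eventually_n_fun_in_terms_of_g_fun
  unfolding eventually_at by (simp add: dist_norm)

end
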